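(* Let $\mathbb{C}$ be a category with a terminal object $1$ and let $\mathbb{D}$ be a category with an initial object $0$. Let $\mathbf{1}$ be the full subcategory of all terminal objects of $\mathbb{C}$ and $\mathbf{0}$ the full subcategory of all initial objects of $\mathbb{D}$. Then $(\mathbb{C}\times\mathbf{0},\ \mathbf{1}\times\mathbb{D})$ is a pretorsion theory in the product category $\mathbb{C}\times\mathbb{D}$ if and only if every morphism $C\to 1$ in $\mathbb{C}$ is an epimorphism and every morphism $0\to D$ in $\mathbb{D}$ is a monomorphism.
   Context: Let $\mathcal{C}$ be a category and $\mathcal{T},\mathcal{F}$ subcategories of $\mathcal{C}$; put $\mathcal{Z}=\mathcal{T}\cap\mathcal{F}$. A morphism of $\mathcal{C}$ is called null if it factors through an object of $\mathcal{Z}$; let $\mathcal{N}$ be the ideal of null morphisms. A morphism $k\colon K\to A$ is a kernel of $f\colon A\to B$ (relative to $\mathcal{N}$) if $fk$ is null and for every $u\colon U\to A$ with $fu$ null there is a unique $u'\colon U\to K$ with $u=ku'$. Dually, $c\colon B\to Q$ is a cokernel of $f\colon A\to B$ if $cf$ is null and for every $v\colon B\to V$ with $vf$ null there is a unique $v'\colon Q\to V$ with $v=v'c$. A short exact sequence is a sequence $A\xrightarrow{m}B\xrightarrow{e}C$ such that $m$ is a kernel of $e$ and $e$ is a cokernel of $m$. A pretorsion theory in $\mathcal{C}$ is a pair $(\mathcal{T},\mathcal{F})$ of full replete (i.e. closed under isomorphism) subcategories of $\mathcal{C}$ such that: (T1) every morphism from an object of $\mathcal{T}$ to an object of $\mathcal{F}$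 is null; (T2) for every object $C$ of $\mathcal{C}$ there is a short exact sequence $T\to C\to F$ with $T\in\mathcal{T}$ and $F\in\mathcal{F}$. *)

theory Defs
  imports Main
begin

text \<open>The value of \<open>Comp C g f\<close> is only meaningful when \<open>Cod C f = Dom C g\<close>
  (first \<open>f\<close>, then \<open>g\<close>); outside their natural domains the operations are unconstrained.\<close>

record ('o, 'm) cat =
  Obj :: "'o set"
  Arr :: "'m set"
  Dom :: "'m \<Rightarrow> 'o"
  Cod :: "'m \<Rightarrow> 'o"
  Ident :: "'o \<Rightarrow> 'm"
  Comp :: "'m \<Rightarrow> 'm \<Rightarrow> 'm"  (infixr "\<cdot>\<index>" 70)

definition Hom :: "('o, 'm) cat \<Rightarrow> 'o \<Rightarrow> 'o \<Rightarrow> 'm set" where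
  "Hom C A B = {f \<in> Arr C. Dom C f = A \<and> Cod C f = B}"

locale category =
  fixes C :: "('o, 'm) cat" (structure)
  assumes Dom_Obj: "f \<in> Arr C \<Longrightarrow> Dom C f \<in> Obj C"
    and Cod_Obj: "f \<in> Arr C \<Longrightarrow> Cod C f \<in> Obj C"
    and Ident_Hom: "A \<in> Obj C \<Longrightarrow> Ident C A \<in> Hom C A A"
    and Comp_Hom: "\<lbrakk>f \<in> Hom C X Y; g \<in> Hom C Y Z\<rbrakk> \<Longrightarrow> g \<cdot> f \<in> Hom C X Z"
    and Comp_Ident: "f \<in> Hom C X Y \<Longrightarrow> f \<cdot> Ident C X = f"
    and Ident_Comp: "f \<in> Hom C X Y \<Longrightarrow> Ident C Y \<cdot> f = f"
    and Comp_assoc: "\<lbrakk>f \<in> Hom C W X; g \<in> Hom C X Y; h \<in> Hom C Y Z\<rbrakk>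
                      \<Longrightarrow> (h \<cdot> g) \<cdot> f = h \<cdot> (g \<cdot> f)"

definition epi :: "('o, 'm) cat \<Rightarrow> 'm \<Rightarrow> bool" where
  "epi C f \<longleftrightarrow> f \<in> Arr C \<and>
     (\<forall>Y. \<forall>g \<in> Hom C (Cod C f) Y. \<forall>h \<in> Hom C (Cod C f) Y.
        g \<cdot>\<^bsub>C\<^esub> f = h \<cdot>\<^bsub>C\<^esub> f \<longrightarrow> g = h)"

definition mono_arr :: "('o, 'm) cat \<Rightarrow> 'm \<Rightarrow> bool" where
  "mono_arr C f \<longleftrightarrow> f \<in> Arr C \<and>
     (\<forall>X. \<forall>g \<in> Hom C X (Dom C f). \<forall>h \<in> Hom C X (Dom C f).
        f \<cdot>\<^bsub>C\<^esub> g = f \<cdot>\<^bsub>C\<^esub> h \<longrightarrow> g = h)"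

definition isomorphic :: "('o, 'm) cat \<Rightarrow> 'o \<Rightarrow> 'o \<Rightarrow> bool" where
  "isomorphic C A B \<longleftrightarrow>
     (\<exists>f \<in> Hom C A B. \<exists>g \<in> Hom C B A. g \<cdot>\<^bsub>C\<^esub> f = Ident C A \<and> f \<cdot>\<^bsub>C\<^esub> g = Ident C B)"

definition terminal :: "('o, 'm) cat \<Rightarrow> 'o \<Rightarrow> bool" where
  "terminal C A \<longleftrightarrow> A \<in> Obj C \<and> (\<forall>X \<in> Obj C. \<exists>!f. f \<in> Hom C X A)"

definition initial :: "('o, 'm) cat \<Rightarrow> 'o \<Rightarrow> bool" where
  "initial C A \<longleftrightarrow> A \<in> Obj C \<and> (\<forall>X \<in> Obj C. \<exists>!f. f \<in> Hom C A X)"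

definition product_cat :: "('o, 'm) cat \<Rightarrow> ('p, 'n) cat \<Rightarrow> ('o \<times> 'p, 'm \<times> 'n) cat"
    (infixr "\<times>\<^sub>c" 80) where
  "C \<times>\<^sub>c D =
     \<lparr> Obj = Obj C \<times> Obj D,
       Arr = Arr C \<times> Arr D,
       Dom = (\<lambda>(f, g). (Dom C f, Dom D g)),
       Cod = (\<lambda>(f, g). (Cod C f, Cod D g)),
       Ident = (\<lambda>(A, B). (Ident C A, Ident D B)),
       Comp = (\<lambda>(f', g') (f, g). (f' \<cdot>\<^bsub>C\<^esub> f, g' \<cdot>\<^bsub>D\<^esub> g)) \<rparr>"

definition subcategory :: "('o, 'm) cat \<Rightarrow> ('o, 'm) cat \<Rightarrow> bool" where
  "subcategory S C \<longleftrightarrow> category S \<and> Obj S \<subseteq> Obj C \<and> Arr S \<subseteq> Arr C \<and>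
     (\<forall>f \<in> Arr S. Dom S f = Dom C f \<and> Cod S f = Cod C f) \<and>
     (\<forall>A \<in> Obj S. Ident S A = Ident C A) \<and>
     (\<forall>f \<in> Arr S. \<forall>g \<in> Arr S. Cod S f = Dom S g \<longrightarrow> g \<cdot>\<^bsub>S\<^esub> f = g \<cdot>\<^bsub>C\<^esub> f)"

definition full_subcategory :: "('o, 'm) cat \<Rightarrow> ('o, 'm) cat \<Rightarrow> bool" where
  "full_subcategory S C \<longleftrightarrow> subcategory S C \<and>
     (\<forall>A \<in> Obj S. \<forall>B \<in> Obj S. Hom C A B \<subseteq> Arr S)"

definition replete :: "('o, 'm) cat \<Rightarrow> ('o, 'm) cat \<Rightarrow> bool" where
  "replete S C \<longleftrightarrow> (\<forall>A \<in> Obj S. \<forall>B \<in> Obj C. isomorphic C A B \<longrightarrow> B \<in> Obj S)"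

definition full_on :: "('o, 'm) cat \<Rightarrow> 'o set \<Rightarrow> ('o, 'm) cat" where
  "full_on C S = C \<lparr> Obj := S, Arr := {f \<in> Arr C. Dom C f \<in> S \<and> Cod C f \<in> S} \<rparr>"

definition terminals :: "('o, 'm) cat \<Rightarrow> ('o, 'm) cat" where
  "terminals C = full_on C {A. terminal C A}"

definition initials :: "('o, 'm) cat \<Rightarrow> ('o, 'm) cat" where
  "initials C = full_on C {A. initial C A}"

definition null_arrows :: "('o, 'm) cat \<Rightarrow> ('o, 'm) cat \<Rightarrow> ('o, 'm) cat \<Rightarrow> 'm set" where
  "null_arrows C T F =
     {f \<in> Arr C. \<exists>Z \<in> Obj T \<inter> Obj F. \<exists>g \<in> Hom C (Dom C f) Z. \<exists>h \<in> Hom C Z (Cod C f).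
        f = h \<cdot>\<^bsub>C\<^esub> g}"

text \<open>Kernels and cokernels relative to a class \<open>N\<close> of arrows.\<close>

definition is_kernel :: "('o, 'm) cat \<Rightarrow> 'm set \<Rightarrow> 'm \<Rightarrow> 'm \<Rightarrow> bool" where
  "is_kernel C N k f \<longleftrightarrow> k \<in> Arr C \<and> f \<in> Arr C \<and> Cod C k = Dom C f \<and> f \<cdot>\<^bsub>C\<^esub> k \<in> N \<and>
     (\<forall>U. \<forall>u \<in> Hom C U (Dom C f). f \<cdot>\<^bsub>C\<^esub> u \<in> N \<longrightarrow>
        (\<exists>!u'. u' \<in> Hom C U (Dom C k) \<and> u = k \<cdot>\<^bsub>C\<^esub> u'))"

definition is_cokernel :: "('o, 'm) cat \<Rightarrow> 'm set \<Rightarrow> 'm \<Rightarrow> 'm \<Rightarrow> bool" where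
  "is_cokernel C N c f \<longleftrightarrow> c \<in> Arr C \<and> f \<in> Arr C \<and> Dom C c = Cod C f \<and> c \<cdot>\<^bsub>C\<^esub> f \<in> N \<and>
     (\<forall>V. \<forall>v \<in> Hom C (Cod C f) V. v \<cdot>\<^bsub>C\<^esub> f \<in> N \<longrightarrow>
        (\<exists>!v'. v' \<in> Hom C (Cod C c) V \<and> v = v' \<cdot>\<^bsub>C\<^esub> c))"

definition short_exact :: "('o, 'm) cat \<Rightarrow> 'm set \<Rightarrow> 'm \<Rightarrow> 'm \<Rightarrow> bool" where
  "short_exact C N m e \<longleftrightarrow> is_kernel C N m e \<and> is_cokernel C N e m"

definition pretorsion_theory :: "('o, 'm) cat \<Rightarrow> ('o, 'm) cat \<Rightarrow> ('o, 'm) cat \<Rightarrow> bool" where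
  "pretorsion_theory C T F \<longleftrightarrow>
     full_subcategory T C \<and> replete T C \<and> full_subcategory F C \<and> replete F C \<and>
     (\<forall>A \<in> Obj T. \<forall>B \<in> Obj F. Hom C A B \<subseteq> null_arrows C T F) \<and>
     (\<forall>X \<in> Obj C. \<exists>A \<in> Obj T. \<exists>B \<in> Obj F. \<exists>m \<in> Hom C A X. \<exists>e \<in> Hom C X B.
        short_exact C (null_arrows C T F) m e)"

end

theory Submission
  imports Defs
begin

text \<open>
  An arrow of the product is null iff its first component factors through a terminal object and
  its second component through an initial one. If the arrows to \<open>1\<close> are epi and those from \<open>0\<close>
  mono, then \<open>(X, 0) \<rightarrow> (X, Y) \<rightarrow> (1, Y)\<close> is short exact. Conversely, in any short exact sequence
  \<open>(A, 0) \<rightarrow> (X, Y) \<rightarrow> (1, B)\<close>, two arrows \<open>1 \<rightarrow> V\<close> that agree after \<open>X \<rightarrow> 1\<close> give, paired with the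
  identity of \<open>B\<close>, two factorizations of the same arrow through the cokernel, so they are equal;
  the kernel yields the dual claim.
\<close>

section \<open>Product categories and full subcategories\<close>

lemma product_cat_simps [simp]:
  "Obj (C \<times>\<^sub>c D) = Obj C \<times> Obj D"
  "Arr (C \<times>\<^sub>c D) = Arr C \<times> Arr D"
  "Dom (C \<times>\<^sub>c D) (f, g) = (Dom C f, Dom D g)"
  "Cod (C \<times>\<^sub>c D) (f, g) = (Cod C f, Cod D g)"
  "Ident (C \<times>\<^sub>c D) (A, B) = (Ident C A, Ident D B)"
  "(f', g') \<cdot>\<^bsub>C \<times>\<^sub>c D\<^esub> (f, g) = (f' \<cdot>\<^bsub>C\<^esub> f, g' \<cdot>\<^bsub>D\<^esub> g)"
  by (simp_all add: product_cat_def)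

lemma Hom_product_cat [simp]:
  "Hom (C \<times>\<^sub>c D) (A, B) (A', B') = Hom C A A' \<times> Hom D B B'"
  by (auto simp: Hom_def)

lemma full_on_simps [simp]:
  "Obj (full_on C S) = S"
  "Arr (full_on C S) = {f \<in> Arr C. Dom C f \<in> S \<and> Cod C f \<in> S}"
  "Dom (full_on C S) = Dom C"
  "Cod (full_on C S) = Cod C"
  "Ident (full_on C S) = Ident C"
  "Comp (full_on C S) = Comp C"
  by (simp_all add: full_on_def)

lemma Hom_full_on: "f \<in> Hom (full_on C S) A B \<longleftrightarrow> f \<in> Hom C A B \<and> A \<in> S \<and> B \<in> S"
  by (auto simp: Hom_def)

lemma Obj_terminals [simp]: "Obj (terminals C) = {A. terminal C A}"
  by (simp add: terminals_def)

lemma Obj_initials [simp]: "Obj (initials C) = {A. initial C A}"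
  by (simp add: initials_def)

lemma HomD: "f \<in> Hom C A B \<Longrightarrow> f \<in> Arr C \<and> Dom C f = A \<and> Cod C f = B"
  by (simp add: Hom_def)

lemma (in category) Hom_Obj: "f \<in> Hom C A B \<Longrightarrow> A \<in> Obj C \<and> B \<in> Obj C"
  using Dom_Obj Cod_Obj by (auto simp: Hom_def)

lemma category_product_cat:
  assumes "category C" and "category D"
  shows "category (C \<times>\<^sub>c D)"
proof -
  interpret C: category C by fact
  interpret D: category D by fact
  show ?thesis
  proof
    fix f assume "f \<in> Arr (C \<times>\<^sub>c D)"
    then show "Dom (C \<times>\<^sub>c D) f \<in> Obj (C \<times>\<^sub>c D)" "Cod (C \<times>\<^sub>c D) f \<in> Obj (C \<times>\<^sub>c D)"
      by (cases f; simp add: C.Dom_Obj D.Dom_Obj C.Cod_Obj D.Cod_Obj)+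
  next
    fix A assume "A \<in> Obj (C \<times>\<^sub>c D)"
    then show "Ident (C \<times>\<^sub>c D) A \<in> Hom (C \<times>\<^sub>c D) A A"
      by (cases A) (simp add: C.Ident_Hom D.Ident_Hom)
  next
    fix f g X Y Z
    assume "f \<in> Hom (C \<times>\<^sub>c D) X Y" "g \<in> Hom (C \<times>\<^sub>c D) Y Z"
    then show "g \<cdot>\<^bsub>C \<times>\<^sub>c D\<^esub> f \<in> Hom (C \<times>\<^sub>c D) X Z"
      by (cases X; cases Y; cases Z) (auto intro: C.Comp_Hom D.Comp_Hom)
  next
    fix f X Y
    assume "f \<in> Hom (C \<times>\<^sub>c D) X Y"
    then show "f \<cdot>\<^bsub>C \<times>\<^sub>c D\<^esub> Ident (C \<times>\<^sub>c D) X = f" "Ident (C \<times>\<^sub>c D) Y \<cdot>\<^bsub>C \<times>\<^sub>c D\<^esub> f = f"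
      by (cases X; cases Y;
          auto simp: C.Comp_Ident D.Comp_Ident C.Ident_Comp D.Ident_Comp)+
  next
    fix f g h W X Y Z
    assume "f \<in> Hom (C \<times>\<^sub>c D) W X" "g \<in> Hom (C \<times>\<^sub>c D) X Y" "h \<in> Hom (C \<times>\<^sub>c D) Y Z"
    then show "(h \<cdot>\<^bsub>C \<times>\<^sub>c D\<^esub> g) \<cdot>\<^bsub>C \<times>\<^sub>c D\<^esub> f = h \<cdot>\<^bsub>C \<times>\<^sub>c D\<^esub> (g \<cdot>\<^bsub>C \<times>\<^sub>c D\<^esub> f)"
      by (cases W; cases X; cases Y; cases Z) (auto simp: C.Comp_assoc D.Comp_assoc)
  qed
qed

lemma full_subcategory_refl: "category C \<Longrightarrow> full_subcategory C C"
  by (auto simp: full_subcategory_def subcategory_def Hom_def)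

lemma (in category) full_subcategory_full_on:
  assumes "S \<subseteq> Obj C"
  shows "full_subcategory (full_on C S) C"
proof -
  have "category (full_on C S)"
    using assms
    by unfold_locales
      (auto simp: Hom_full_on intro: Ident_Hom Comp_Hom Comp_Ident Ident_Comp Comp_assoc)
  then show ?thesis
    using assms by (auto simp: full_subcategory_def subcategory_def Hom_def)
qed

lemma full_subcategory_product_cat:
  assumes "full_subcategory S C" and "full_subcategory S' C'"
  shows "full_subcategory (S \<times>\<^sub>c S') (C \<times>\<^sub>c C')"
proof -
  have "category (S \<times>\<^sub>c S')"
    using assms by (simp add: full_subcategory_def subcategory_def category_product_cat)
  then show ?thesis
    using assms by (auto simp: full_subcategory_def subcategory_def; blast)
qed

text \<open>An inverse pair in the product is an inverse pair in each component. This reduces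
  repleteness of a product subcategory to repleteness of its two factors.\<close>

lemma isomorphic_product_catD:
  assumes "isomorphic (C \<times>\<^sub>c D) (A, B) (A', B')"
  shows "isomorphic C A A'" and "isomorphic D B B'"
  using assms by (auto simp: isomorphic_def)

lemma replete_refl: "replete C C"
  by (simp add: replete_def)

lemma replete_product_cat:
  assumes "replete S C" and "replete S' C'"
  shows "replete (S \<times>\<^sub>c S') (C \<times>\<^sub>c C')"
  using assms unfolding replete_def by (auto; blast dest: isomorphic_product_catD)

section \<open>Terminal and initial objects up to isomorphism\<close>

lemma terminal_Obj: "terminal C A \<Longrightarrow> A \<in> Obj C"
  by (simp add: terminal_def)

lemma initial_Obj: "initial C A \<Longrightarrow> A \<in> Obj C"
  by (simp add: initial_def)

lemma terminal_arrow:
  assumes "terminal C A" and "X \<in> Obj C"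
  obtains f where "f \<in> Hom C X A"
  using assms by (auto simp: terminal_def)

lemma terminal_unique:
  assumes "terminal C A" and "X \<in> Obj C" and "f \<in> Hom C X A" and "g \<in> Hom C X A"
  shows "f = g"
  using assms by (auto simp: terminal_def)

lemma initial_arrow:
  assumes "initial C A" and "X \<in> Obj C"
  obtains f where "f \<in> Hom C A X"
  using assms by (auto simp: initial_def)

lemma initial_unique:
  assumes "initial C A" and "X \<in> Obj C" and "f \<in> Hom C A X" and "g \<in> Hom C A X"
  shows "f = g"
  using assms by (auto simp: initial_def)

context category
begin

text \<open>Both round trips are endomorphisms of a terminal object, hence identities. This later
  allows an arbitrary terminal object to be exchanged for the fixed \<open>one\<close>.\<close>

lemma terminal_isomorphic:
  assumes "terminal C A" and "terminal C B"
  shows "isomorphic C A B"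
proof -
  have AB: "A \<in> Obj C" "B \<in> Obj C" using assms by (simp_all add: terminal_Obj)
  obtain f where f: "f \<in> Hom C A B" using terminal_arrow assms(2) AB(1) .
  obtain g where g: "g \<in> Hom C B A" using terminal_arrow assms(1) AB(2) .
  have "g \<cdot> f = Ident C A"
    using terminal_unique[OF assms(1) AB(1) Comp_Hom[OF f g] Ident_Hom[OF AB(1)]] .
  moreover have "f \<cdot> g = Ident C B"
    using terminal_unique[OF assms(2) AB(2) Comp_Hom[OF g f] Ident_Hom[OF AB(2)]] .
  ultimately show ?thesis
    using f g by (auto simp: isomorphic_def)
qed

lemma initial_isomorphic:
  assumes "initial C A" and "initial C B"
  shows "isomorphic C A B"
proof -
  have AB: "A \<in> Obj C" "B \<in> Obj C" using assms by (simp_all add: initial_Obj)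
  obtain f where f: "f \<in> Hom C A B" using initial_arrow assms(1) AB(2) .
  obtain g where g: "g \<in> Hom C B A" using initial_arrow assms(2) AB(1) .
  have "g \<cdot> f = Ident C A"
    using initial_unique[OF assms(1) AB(1) Comp_Hom[OF f g] Ident_Hom[OF AB(1)]] .
  moreover have "f \<cdot> g = Ident C B"
    using initial_unique[OF assms(2) AB(2) Comp_Hom[OF g f] Ident_Hom[OF AB(2)]] .
  ultimately show ?thesis
    using f g by (auto simp: isomorphic_def)
qed

text \<open>An arrow \<open>h\<close> into \<open>B\<close> is recovered as
  \<open>f \<cdot> (g \<cdot> h)\<close>, and \<open>g \<cdot> h\<close> is forced because it ends
  in the terminal object \<open>A\<close>. This makes the subcategory of terminal objects
  replete.\<close>

lemma isomorphic_terminal: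
  assumes "terminal C A" and "isomorphic C A B"
  shows "terminal C B"
proof -
  obtain f g where f: "f \<in> Hom C A B" and g: "g \<in> Hom C B A" and fg: "f \<cdot> g = Ident C B"
    using assms(2) by (auto simp: isomorphic_def)
  have "\<exists>!h. h \<in> Hom C X B" if X: "X \<in> Obj C" for X
  proof -
    obtain k where k: "k \<in> Hom C X A" using terminal_arrow assms(1) X .
    have "h = f \<cdot> k" if h: "h \<in> Hom C X B" for h
    proof -
      have "h = f \<cdot> (g \<cdot> h)"
        using Comp_assoc[OF h g f] fg Ident_Comp[OF h] by simp
      moreover have "g \<cdot> h = k"
        using terminal_unique[OF assms(1) X Comp_Hom[OF h g] k] .
      ultimately show ?thesis by simp
    qed
    then show ?thesis using Comp_Hom[OF k f] by blast
  qed
  then show ?thesis using Hom_Obj[OF f] by (simp add: terminal_def)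
qed

text \<open>Dually, an arrow \<open>h\<close> out of \<open>B\<close> is recovered as
  \<open>(h \<cdot> f) \<cdot> g\<close>, where \<open>h \<cdot> f\<close> starts at the initial
  object \<open>A\<close> and is therefore forced.\<close>

lemma isomorphic_initial:
  assumes "initial C A" and "isomorphic C A B"
  shows "initial C B"
proof -
  obtain f g where f: "f \<in> Hom C A B" and g: "g \<in> Hom C B A" and fg: "f \<cdot> g = Ident C B"
    using assms(2) by (auto simp: isomorphic_def)
  have "\<exists>!h. h \<in> Hom C B X" if X: "X \<in> Obj C" for X
  proof -
    obtain k where k: "k \<in> Hom C A X" using initial_arrow assms(1) X .
    have "h = k \<cdot> g" if h: "h \<in> Hom C B X" for h
    proof -
      have "h = (h \<cdot> f) \<cdot> g"
        using Comp_assoc[OF g f h] fg Comp_Ident[OF h] by simp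
      moreover have "h \<cdot> f = k"
        using initial_unique[OF assms(1) X Comp_Hom[OF f h] k] .
      ultimately show ?thesis by simp
    qed
    then show ?thesis using Comp_Hom[OF g k] by blast
  qed
  then show ?thesis using Hom_Obj[OF f] by (simp add: initial_def)
qed

lemma full_subcategory_terminals: "full_subcategory (terminals C) C"
  unfolding terminals_def by (rule full_subcategory_full_on) (auto dest: terminal_Obj)

lemma replete_terminals: "replete (terminals C) C"
  unfolding replete_def Obj_terminals using isomorphic_terminal by blast

lemma full_subcategory_initials: "full_subcategory (initials C) C"
  unfolding initials_def by (rule full_subcategory_full_on) (auto dest: initial_Obj)

lemma replete_initials: "replete (initials C) C"
  unfolding replete_def Obj_initials using isomorphic_initial by blast

end

section \<open>Factorization through an object and null arrows of the product\<close>

definition factors_through :: "('o, 'm) cat \<Rightarrow> 'o \<Rightarrow> 'm \<Rightarrow> bool" where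
  "factors_through C Z f \<longleftrightarrow>
     (\<exists>g \<in> Hom C (Dom C f) Z. \<exists>h \<in> Hom C Z (Cod C f). f = h \<cdot>\<^bsub>C\<^esub> g)"

context category
begin

lemma factors_through_Arr: "factors_through C Z f \<Longrightarrow> f \<in> Arr C"
  by (auto simp: factors_through_def dest: Comp_Hom HomD)

lemma factors_through_Comp:
  assumes "g \<in> Hom C X Z" and "h \<in> Hom C Z Y"
  shows "factors_through C Z (h \<cdot> g)"
  using assms HomD[OF Comp_Hom[OF assms]] by (auto simp: factors_through_def)

lemma factors_through_Dom: "f \<in> Hom C Z Y \<Longrightarrow> factors_through C Z f"
  using factors_through_Comp[of "Ident C Z" Z Z f Y] by (simp add: Comp_Ident Ident_Hom Hom_Obj)

lemma factors_through_Cod: "f \<in> Hom C X Z \<Longrightarrow> factors_through C Z f"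
  using factors_through_Comp[of f X Z "Ident C Z" Z] by (simp add: Ident_Comp Ident_Hom Hom_Obj)

text \<open>Inserting \<open>t \<cdot> s = Ident C Z\<close> between the two halves of a
  factorization moves its middle object from \<open>Z\<close> to \<open>Z'\<close>.\<close>

lemma factors_through_isomorphic:
  assumes "factors_through C Z f" and "isomorphic C Z Z'"
  shows "factors_through C Z' f"
proof -
  obtain g h where g: "g \<in> Hom C (Dom C f) Z" and h: "h \<in> Hom C Z (Cod C f)" and f: "f = h \<cdot> g"
    using assms(1) by (auto simp: factors_through_def)
  obtain s t where s: "s \<in> Hom C Z Z'" and t: "t \<in> Hom C Z' Z" and ts: "t \<cdot> s = Ident C Z"
    using assms(2) by (auto simp: isomorphic_def)
  have "(h \<cdot> t) \<cdot> (s \<cdot> g) = h \<cdot> (t \<cdot> (s \<cdot> g))"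
    using Comp_assoc[OF Comp_Hom[OF g s] t h] .
  also have "\<dots> = f"
    using Comp_assoc[OF g s t] ts Ident_Comp[OF g] f by simp
  finally show ?thesis
    using factors_through_Comp[OF Comp_Hom[OF g s] Comp_Hom[OF t h]] by simp
qed

end

text \<open>The middle object of a null arrow lies in both subcategories, so it is a pair of a
  terminal and an initial object, and factorizations in the product are formed componentwise. The
  criterion holds for every choice of \<open>one\<close> and \<open>zero\<close>.\<close>

lemma null_arrows_product_cat:
  assumes "category C" and "category D" and "terminal C one" and "initial D zero"
  shows "(f, g) \<in> null_arrows (C \<times>\<^sub>c D) (C \<times>\<^sub>c initials D) (terminals C \<times>\<^sub>c D) \<longleftrightarrow>
    factors_through C one f \<and> factors_through D zero g"
proof -
  interpret C: category C by fact
  interpret D: category D by fact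
  have "Obj (C \<times>\<^sub>c initials D) \<inter> Obj (terminals C \<times>\<^sub>c D) = Collect (terminal C) \<times> Collect (initial D)"
    by (auto dest: terminal_Obj initial_Obj)
  then have "(f, g) \<in> null_arrows (C \<times>\<^sub>c D) (C \<times>\<^sub>c initials D) (terminals C \<times>\<^sub>c D) \<longleftrightarrow>
    (f, g) \<in> Arr C \<times> Arr D \<and>
    (\<exists>t. terminal C t \<and> factors_through C t f) \<and> (\<exists>i. initial D i \<and> factors_through D i g)"
    unfolding null_arrows_def factors_through_def by (simp add: Bex_def) blast
  \<comment> \<open>From left to right, the unknown terminal and initial objects are traded for
    \<open>one\<close> and \<open>zero\<close> along isomorphisms.\<close>
  also have "\<dots> \<longleftrightarrow> factors_through C one f \<and> factors_through D zero g"
    using assms C.factors_through_Arr D.factors_through_Arr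
      C.factors_through_isomorphic D.factors_through_isomorphic
      C.terminal_isomorphic D.initial_isomorphic by blast
  finally show ?thesis .
qed

section \<open>The pretorsion axioms from the epi and mono conditions\<close>

context
  fixes C :: "('o, 'm) cat" and D :: "('p, 'n) cat" and one :: 'o and zero :: 'p
  assumes C: "category C" and D: "category D"
    and one: "terminal C one" and zero: "initial D zero"
begin

interpretation C: category C by (rule C)
interpretation D: category D by (rule D)

abbreviation (input) null where
  "null \<equiv> null_arrows (C \<times>\<^sub>c D) (C \<times>\<^sub>c initials D) (terminals C \<times>\<^sub>c D)"

lemmas null_iff = null_arrows_product_cat[OF C D one zero]

lemma one_Obj: "one \<in> Obj C" and zero_Obj: "zero \<in> Obj D"
  using one zero by (simp_all add: terminal_Obj initial_Obj)

lemma null_torsion_torsion_free: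
  assumes "A \<in> Obj (C \<times>\<^sub>c initials D)" and "B \<in> Obj (terminals C \<times>\<^sub>c D)"
  shows "Hom (C \<times>\<^sub>c D) A B \<subseteq> null"
proof
  fix h assume h: "h \<in> Hom (C \<times>\<^sub>c D) A B"
  obtain X i Y t f g where eqs: "A = (X, i)" "B = (t, Y)" "h = (f, g)"
    by (cases A, cases B, cases h)
  have f: "f \<in> Hom C X t" and g: "g \<in> Hom D i Y" and t: "terminal C t" and i: "initial D i"
    using assms h eqs by auto
  show "h \<in> null"
    \<comment> \<open>The criterion is taken at \<open>t\<close> and \<open>i\<close> themselves,
      the codomain of \<open>f\<close> and the domain of \<open>g\<close>, so that factoring through
      an identity suffices.\<close>
    unfolding eqs null_arrows_product_cat[OF C D t i]
    using C.factors_through_Cod[OF f] D.factors_through_Dom[OF g] by simp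
qed

text \<open>If \<open>(u1, u2)\<close> becomes null, then \<open>u2\<close> factors through
  \<open>zero\<close>, hence through \<open>z\<close>, the only arrow from \<open>zero\<close> to
  \<open>Y\<close>. Uniqueness of the lift comes from the identity in the first component and from
  \<open>z\<close> being mono in the second.\<close>

lemma kernel_if_mono:
  assumes X: "X \<in> Obj C" and Y: "Y \<in> Obj D"
    and t: "t \<in> Hom C X one" and z: "z \<in> Hom D zero Y" and mono: "mono_arr D z"
  shows "is_kernel (C \<times>\<^sub>c D) null (Ident C X, z) (t, Ident D Y)"
proof -
  note idX = C.Ident_Hom[OF X] and idY = D.Ident_Hom[OF Y]
  have ex: "\<exists>!w. w \<in> Hom (C \<times>\<^sub>c D) U (X, zero) \<and> u = (Ident C X, z) \<cdot>\<^bsub>C \<times>\<^sub>c D\<^esub> w"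
    if u: "u \<in> Hom (C \<times>\<^sub>c D) U (X, Y)" and null: "(t, Ident D Y) \<cdot>\<^bsub>C \<times>\<^sub>c D\<^esub> u \<in> null" for U u
  proof -
    obtain U1 U2 u1 u2 where eqs: "U = (U1, U2)" "u = (u1, u2)"
      by (cases U, cases u)
    have u1: "u1 \<in> Hom C U1 X" and u2: "u2 \<in> Hom D U2 Y"
      using u eqs by auto
    have "factors_through D zero u2"
      using null eqs by (simp add: null_iff D.Ident_Comp[OF u2])
    then obtain w k where w: "w \<in> Hom D U2 zero" and k: "k \<in> Hom D zero Y" and u2w: "u2 = k \<cdot>\<^bsub>D\<^esub> w"
      using HomD[OF u2] by (auto simp: factors_through_def)
    have kz: "k = z" using initial_unique[OF zero Y k z] .
    show ?thesis
    proof (rule ex1I[of _ "(u1, w)"])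
      show "(u1, w) \<in> Hom (C \<times>\<^sub>c D) U (X, zero) \<and> u = (Ident C X, z) \<cdot>\<^bsub>C \<times>\<^sub>c D\<^esub> (u1, w)"
        using u1 w u2w kz eqs by (simp add: C.Ident_Comp[OF u1])
    next
      fix v assume v: "v \<in> Hom (C \<times>\<^sub>c D) U (X, zero) \<and> u = (Ident C X, z) \<cdot>\<^bsub>C \<times>\<^sub>c D\<^esub> v"
      then obtain v1 v2 where v12: "v = (v1, v2)" "v1 \<in> Hom C U1 X" "v2 \<in> Hom D U2 zero"
        "u1 = Ident C X \<cdot>\<^bsub>C\<^esub> v1" "u2 = z \<cdot>\<^bsub>D\<^esub> v2"
        using eqs by (cases v) auto
      have "v1 = u1" using v12 C.Ident_Comp by simp
      moreover have "v2 = w"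
        using mono v12 w u2w kz HomD[OF z] by (auto simp: mono_arr_def)
      ultimately show "v = (u1, w)" using v12 by simp
    qed
  qed
  show ?thesis
    unfolding is_kernel_def
    using HomD[OF idX] HomD[OF idY] HomD[OF t] HomD[OF z] ex
      C.factors_through_Cod[OF t] D.factors_through_Dom[OF z]
    by (simp add: null_iff C.Comp_Ident[OF t] D.Ident_Comp[OF z])
qed

text \<open>Dual to the kernel case: nullness makes \<open>u1\<close> factor through
  \<open>one\<close>, hence through \<open>t\<close>, the only arrow from \<open>X\<close> to
  \<open>one\<close>; that \<open>t\<close> is epi makes the induced arrow unique.\<close>

lemma cokernel_if_epi:
  assumes X: "X \<in> Obj C" and Y: "Y \<in> Obj D"
    and t: "t \<in> Hom C X one" and z: "z \<in> Hom D zero Y" and epi: "epi C t"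
  shows "is_cokernel (C \<times>\<^sub>c D) null (t, Ident D Y) (Ident C X, z)"
proof -
  note idX = C.Ident_Hom[OF X] and idY = D.Ident_Hom[OF Y]
  have ex: "\<exists>!w. w \<in> Hom (C \<times>\<^sub>c D) (one, Y) V \<and> u = w \<cdot>\<^bsub>C \<times>\<^sub>c D\<^esub> (t, Ident D Y)"
    if u: "u \<in> Hom (C \<times>\<^sub>c D) (X, Y) V" and null: "u \<cdot>\<^bsub>C \<times>\<^sub>c D\<^esub> (Ident C X, z) \<in> null" for V u
  proof -
    obtain V1 V2 u1 u2 where eqs: "V = (V1, V2)" "u = (u1, u2)"
      by (cases V, cases u)
    have u1: "u1 \<in> Hom C X V1" and u2: "u2 \<in> Hom D Y V2"
      using u eqs by auto
    have "factors_through C one u1"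
      using null eqs by (simp add: null_iff C.Comp_Ident[OF u1])
    then obtain w k where w: "w \<in> Hom C one V1" and k: "k \<in> Hom C X one" and u1w: "u1 = w \<cdot>\<^bsub>C\<^esub> k"
      using HomD[OF u1] by (auto simp: factors_through_def)
    have kt: "k = t" using terminal_unique[OF one X k t] .
    show ?thesis
    proof (rule ex1I[of _ "(w, u2)"])
      show "(w, u2) \<in> Hom (C \<times>\<^sub>c D) (one, Y) V \<and> u = (w, u2) \<cdot>\<^bsub>C \<times>\<^sub>c D\<^esub> (t, Ident D Y)"
        using u2 w u1w kt eqs by (simp add: D.Comp_Ident[OF u2])
    next
      fix v assume v: "v \<in> Hom (C \<times>\<^sub>c D) (one, Y) V \<and> u = v \<cdot>\<^bsub>C \<times>\<^sub>c D\<^esub> (t, Ident D Y)"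
      then obtain v1 v2 where v12: "v = (v1, v2)" "v1 \<in> Hom C one V1" "v2 \<in> Hom D Y V2"
        "u1 = v1 \<cdot>\<^bsub>C\<^esub> t" "u2 = v2 \<cdot>\<^bsub>D\<^esub> Ident D Y"
        using eqs by (cases v) auto
      have "v2 = u2" using v12 D.Comp_Ident by simp
      moreover have "v1 = w"
        using epi v12 w u1w kt HomD[OF t] by (auto simp: epi_def)
      ultimately show "v = (w, u2)" using v12 by simp
    qed
  qed
  show ?thesis
    unfolding is_cokernel_def
    using HomD[OF idX] HomD[OF idY] HomD[OF t] HomD[OF z] ex
      C.factors_through_Cod[OF t] D.factors_through_Dom[OF z]
    by (simp add: null_iff C.Comp_Ident[OF t] D.Ident_Comp[OF z])
qed

lemma pretorsion_theory_if_epi_mono: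
  assumes epi: "\<And>X f. X \<in> Obj C \<Longrightarrow> f \<in> Hom C X one \<Longrightarrow> epi C f"
    and mono: "\<And>Y g. Y \<in> Obj D \<Longrightarrow> g \<in> Hom D zero Y \<Longrightarrow> mono_arr D g"
  shows "pretorsion_theory (C \<times>\<^sub>c D) (C \<times>\<^sub>c initials D) (terminals C \<times>\<^sub>c D)"
  unfolding pretorsion_theory_def
proof (intro conjI ballI)
  \<comment> \<open>Each subcategory is a product in which one factor is the whole category, full
    and replete in itself; the other factor is handled by closure of terminal or initial objects
    under isomorphism.\<close>
  show "full_subcategory (C \<times>\<^sub>c initials D) (C \<times>\<^sub>c D)"
    "full_subcategory (terminals C \<times>\<^sub>c D) (C \<times>\<^sub>c D)"
    using full_subcategory_product_cat full_subcategory_refl C D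
      C.full_subcategory_terminals D.full_subcategory_initials by blast+
  show "replete (C \<times>\<^sub>c initials D) (C \<times>\<^sub>c D)" "replete (terminals C \<times>\<^sub>c D) (C \<times>\<^sub>c D)"
    using replete_product_cat replete_refl
      C.replete_terminals D.replete_initials by blast+
  show "Hom (C \<times>\<^sub>c D) A B \<subseteq> null"
    if "A \<in> Obj (C \<times>\<^sub>c initials D)" "B \<in> Obj (terminals C \<times>\<^sub>c D)" for A B
    using null_torsion_torsion_free that .
  fix P assume P: "P \<in> Obj (C \<times>\<^sub>c D)"
  then obtain X Y where XY: "P = (X, Y)" and X: "X \<in> Obj C" and Y: "Y \<in> Obj D"
    by auto
  obtain t where t: "t \<in> Hom C X one" using terminal_arrow one X .
  obtain z where z: "z \<in> Hom D zero Y" using initial_arrow zero Y .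
  have "short_exact (C \<times>\<^sub>c D) null (Ident C X, z) (t, Ident D Y)"
    using kernel_if_mono[OF X Y t z mono[OF Y z]] cokernel_if_epi[OF X Y t z epi[OF X t]]
    by (simp add: short_exact_def)
  moreover have "(Ident C X, z) \<in> Hom (C \<times>\<^sub>c D) (X, zero) P" "(t, Ident D Y) \<in> Hom (C \<times>\<^sub>c D) P (one, Y)"
    using XY t z C.Ident_Hom[OF X] D.Ident_Hom[OF Y] by auto
  moreover have "(X, zero) \<in> Obj (C \<times>\<^sub>c initials D)" "(one, Y) \<in> Obj (terminals C \<times>\<^sub>c D)"
    using X Y one zero by auto
  ultimately show "\<exists>A \<in> Obj (C \<times>\<^sub>c initials D). \<exists>B \<in> Obj (terminals C \<times>\<^sub>c D).
      \<exists>m \<in> Hom (C \<times>\<^sub>c D) A P. \<exists>e \<in> Hom (C \<times>\<^sub>c D) P B. short_exact (C \<times>\<^sub>c D) null m e"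
    by blast
qed

section \<open>The epi and mono conditions from a pretorsion theory\<close>

lemma pretorsion_sequence:
  assumes "pretorsion_theory (C \<times>\<^sub>c D) (C \<times>\<^sub>c initials D) (terminals C \<times>\<^sub>c D)"
    and "X \<in> Obj C" and "Y \<in> Obj D"
  obtains A i t B m1 m2 e1 e2 where
    "initial D i" "terminal C t" "m1 \<in> Hom C A X" "m2 \<in> Hom D i Y" "e1 \<in> Hom C X t" "e2 \<in> Hom D Y B"
    "is_kernel (C \<times>\<^sub>c D) null (m1, m2) (e1, e2)" "is_cokernel (C \<times>\<^sub>c D) null (e1, e2) (m1, m2)"
proof -
  have "(X, Y) \<in> Obj (C \<times>\<^sub>c D)" using assms by simp
  then obtain T F m e where *: "T \<in> Obj (C \<times>\<^sub>c initials D)" "F \<in> Obj (terminals C \<times>\<^sub>c D)"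
    "m \<in> Hom (C \<times>\<^sub>c D) T (X, Y)" "e \<in> Hom (C \<times>\<^sub>c D) (X, Y) F" "short_exact (C \<times>\<^sub>c D) null m e"
    using assms(1) unfolding pretorsion_theory_def by blast
  obtain A i t B m1 m2 e1 e2 where "T = (A, i)" "F = (t, B)" "m = (m1, m2)" "e = (e1, e2)"
    by (cases T, cases F, cases m, cases e)
  then show ?thesis using * that[of i t m1 A m2 e1 e2 B] by (simp add: short_exact_def)
qed

lemma epi_if_pretorsion_theory:
  assumes pt: "pretorsion_theory (C \<times>\<^sub>c D) (C \<times>\<^sub>c initials D) (terminals C \<times>\<^sub>c D)"
    and X: "X \<in> Obj C" and f: "f \<in> Hom C X one"
  shows "epi C f"
  unfolding epi_def
proof (intro conjI allI ballI impI)
  show "f \<in> Arr C" using HomD[OF f] by simp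
next
  fix V g h
  assume "g \<in> Hom C (Cod C f) V" "h \<in> Hom C (Cod C f) V" and eq: "g \<cdot>\<^bsub>C\<^esub> f = h \<cdot>\<^bsub>C\<^esub> f"
  then have g: "g \<in> Hom C one V" and h: "h \<in> Hom C one V" using HomD[OF f] by simp_all
  obtain A i t B m1 m2 e1 e2 where i: "initial D i" and t: "terminal C t"
    and m1: "m1 \<in> Hom C A X" and m2: "m2 \<in> Hom D i zero"
    and e1: "e1 \<in> Hom C X t" and e2: "e2 \<in> Hom D zero B"
    and cok: "is_cokernel (C \<times>\<^sub>c D) null (e1, e2) (m1, m2)"
    \<comment> \<open>The claim concerns \<open>C\<close>, so \<open>X\<close> is paired with
      \<open>zero\<close>; this choice also makes \<open>e2 \<cdot> m2\<close> pass through
      \<open>zero\<close>.\<close>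
    using pretorsion_sequence[OF pt X zero_Obj] .
  have tO: "t \<in> Obj C" and BO: "B \<in> Obj D" using C.Hom_Obj[OF e1] D.Hom_Obj[OF e2] by auto
  \<comment> \<open>The exact sequence ends in some terminal object \<open>t\<close>, possibly
    different from \<open>one\<close>; \<open>r\<close> and \<open>s\<close> translate between the
    two.\<close>
  obtain r where r: "r \<in> Hom C t one" using terminal_arrow one tO .
  obtain s where s: "s \<in> Hom C one t" using terminal_arrow t one_Obj .
  have rs: "r \<cdot>\<^bsub>C\<^esub> s = Ident C one"
    using terminal_unique[OF one one_Obj C.Comp_Hom[OF s r] C.Ident_Hom[OF one_Obj]] .
  have re: "r \<cdot>\<^bsub>C\<^esub> e1 = f"
    using terminal_unique[OF one X C.Comp_Hom[OF e1 r] f] .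
  \<comment> \<open>With \<open>e2\<close> as second component, the identity of \<open>B\<close>
    completes any factorization of the first component through \<open>e1\<close>.\<close>
  let ?v = "(g \<cdot>\<^bsub>C\<^esub> f, e2)"
  have v: "?v \<in> Hom (C \<times>\<^sub>c D) (X, zero) (V, B)"
    using C.Comp_Hom[OF f g] e2 by simp
  have "factors_through C one ((g \<cdot>\<^bsub>C\<^esub> f) \<cdot>\<^bsub>C\<^esub> m1)"
    unfolding C.Comp_assoc[OF m1 f g]
    by (rule C.factors_through_Comp[OF C.Comp_Hom[OF m1 f] g])
  then have "?v \<cdot>\<^bsub>C \<times>\<^sub>c D\<^esub> (m1, m2) \<in> null"
    by (simp add: null_iff D.factors_through_Comp[OF m2 e2])
  then have ex: "\<exists>!w. w \<in> Hom (C \<times>\<^sub>c D) (t, B) (V, B) \<and> ?v = w \<cdot>\<^bsub>C \<times>\<^sub>c D\<^esub> (e1, e2)"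
    using cok v HomD[OF m1] HomD[OF m2] HomD[OF e1] HomD[OF e2] unfolding is_cokernel_def by simp
  \<comment> \<open>Both \<open>k = g\<close> and \<open>k = h\<close> qualify, giving two
    factorizations of the same arrow through the cokernel.\<close>
  have fact: "(k \<cdot>\<^bsub>C\<^esub> r, Ident D B) \<in> Hom (C \<times>\<^sub>c D) (t, B) (V, B) \<and>
      ?v = (k \<cdot>\<^bsub>C\<^esub> r, Ident D B) \<cdot>\<^bsub>C \<times>\<^sub>c D\<^esub> (e1, e2)"
    if k: "k \<in> Hom C one V" and kf: "k \<cdot>\<^bsub>C\<^esub> f = g \<cdot>\<^bsub>C\<^esub> f" for k
    using C.Comp_Hom[OF r k] D.Ident_Hom[OF BO] kf
    by (simp add: C.Comp_assoc[OF e1 r k] re D.Ident_Comp[OF e2])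
  have "g \<cdot>\<^bsub>C\<^esub> r = h \<cdot>\<^bsub>C\<^esub> r"
    using ex fact[OF g refl] fact[OF h eq[symmetric]] by blast
  \<comment> \<open>Precomposing with \<open>s\<close> cancels \<open>r\<close>, which turns
    equality of the factorizations into \<open>g = h\<close>.\<close>
  moreover have "(k \<cdot>\<^bsub>C\<^esub> r) \<cdot>\<^bsub>C\<^esub> s = k" if "k \<in> Hom C one V" for k
    unfolding C.Comp_assoc[OF s r that] rs using C.Comp_Ident[OF that] .
  ultimately show "g = h"
    using g h by metis
qed

lemma mono_if_pretorsion_theory:
  assumes pt: "pretorsion_theory (C \<times>\<^sub>c D) (C \<times>\<^sub>c initials D) (terminals C \<times>\<^sub>c D)"
    and Y: "Y \<in> Obj D" and f: "f \<in> Hom D zero Y"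
  shows "mono_arr D f"
  unfolding mono_arr_def
proof (intro conjI allI ballI impI)
  show "f \<in> Arr D" using HomD[OF f] by simp
next
  fix U g h
  assume "g \<in> Hom D U (Dom D f)" "h \<in> Hom D U (Dom D f)" and eq: "f \<cdot>\<^bsub>D\<^esub> g = f \<cdot>\<^bsub>D\<^esub> h"
  then have g: "g \<in> Hom D U zero" and h: "h \<in> Hom D U zero" using HomD[OF f] by simp_all
  obtain A i t B m1 m2 e1 e2 where i: "initial D i" and t: "terminal C t"
    and m1: "m1 \<in> Hom C A one" and m2: "m2 \<in> Hom D i Y"
    and e1: "e1 \<in> Hom C one t" and e2: "e2 \<in> Hom D Y B"
    and ker: "is_kernel (C \<times>\<^sub>c D) null (m1, m2) (e1, e2)"
    \<comment> \<open>Dually, \<open>Y\<close> is paired with \<open>one\<close>, so that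
      \<open>e1 \<cdot> m1\<close> passes through \<open>one\<close>.\<close>
    using pretorsion_sequence[OF pt one_Obj Y] .
  have iO: "i \<in> Obj D" and AO: "A \<in> Obj C" using D.Hom_Obj[OF m2] C.Hom_Obj[OF m1] by auto
  obtain r where r: "r \<in> Hom D zero i" using initial_arrow zero iO .
  obtain s where s: "s \<in> Hom D i zero" using initial_arrow i zero_Obj .
  have sr: "s \<cdot>\<^bsub>D\<^esub> r = Ident D zero"
    using initial_unique[OF zero zero_Obj D.Comp_Hom[OF r s] D.Ident_Hom[OF zero_Obj]] .
  have mr: "m2 \<cdot>\<^bsub>D\<^esub> r = f"
    using initial_unique[OF zero Y D.Comp_Hom[OF r m2] f] .
  \<comment> \<open>The first component \<open>m1\<close> lifts along the kernel by the identity of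
    \<open>A\<close>, and the second lifts by both \<open>r \<cdot> g\<close> and
    \<open>r \<cdot> h\<close>.\<close>
  let ?u = "(m1, f \<cdot>\<^bsub>D\<^esub> g)"
  have u: "?u \<in> Hom (C \<times>\<^sub>c D) (A, U) (one, Y)"
    using D.Comp_Hom[OF g f] m1 by simp
  \<comment> \<open>The arrow \<open>g\<close> already ends in \<open>zero\<close>, so reassociating
    exhibits the factorization.\<close>
  have "factors_through D zero (e2 \<cdot>\<^bsub>D\<^esub> (f \<cdot>\<^bsub>D\<^esub> g))"
    unfolding D.Comp_assoc[OF g f e2, symmetric]
    by (rule D.factors_through_Comp[OF g D.Comp_Hom[OF f e2]])
  then have "(e1, e2) \<cdot>\<^bsub>C \<times>\<^sub>c D\<^esub> ?u \<in> null"
    by (simp add: null_iff C.factors_through_Comp[OF m1 e1])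
  then have ex: "\<exists>!w. w \<in> Hom (C \<times>\<^sub>c D) (A, U) (A, i) \<and> ?u = (m1, m2) \<cdot>\<^bsub>C \<times>\<^sub>c D\<^esub> w"
    using ker u HomD[OF m1] HomD[OF m2] HomD[OF e1] HomD[OF e2] unfolding is_kernel_def by simp
  have fact: "(Ident C A, r \<cdot>\<^bsub>D\<^esub> k) \<in> Hom (C \<times>\<^sub>c D) (A, U) (A, i) \<and>
      ?u = (m1, m2) \<cdot>\<^bsub>C \<times>\<^sub>c D\<^esub> (Ident C A, r \<cdot>\<^bsub>D\<^esub> k)"
    if k: "k \<in> Hom D U zero" and fk: "f \<cdot>\<^bsub>D\<^esub> k = f \<cdot>\<^bsub>D\<^esub> g" for k
    using D.Comp_Hom[OF k r] C.Ident_Hom[OF AO] fk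
    by (simp add: D.Comp_assoc[OF k r m2, symmetric] mr C.Comp_Ident[OF m1])
  have "r \<cdot>\<^bsub>D\<^esub> g = r \<cdot>\<^bsub>D\<^esub> h"
    using ex fact[OF g refl] fact[OF h eq[symmetric]] by blast
  moreover have "s \<cdot>\<^bsub>D\<^esub> (r \<cdot>\<^bsub>D\<^esub> k) = k" if "k \<in> Hom D U zero" for k
    unfolding D.Comp_assoc[OF that r s, symmetric] sr using D.Ident_Comp[OF that] .
  ultimately show "g = h"
    using g h by metis
qed

end

theorem theorem2p2:
  fixes C :: "('o, 'm) cat" and D :: "('p, 'n) cat" and one :: 'o and zero :: 'p
  assumes "category C" and "category D"
    and "terminal C one" and "initial D zero"
  shows "pretorsion_theory (C \<times>\<^sub>c D) (C \<times>\<^sub>c initials D) (terminals C \<times>\<^sub>c D) \<longleftrightarrow>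
    (\<forall>X \<in> Obj C. \<forall>f \<in> Hom C X one. epi C f) \<and>
    (\<forall>Y \<in> Obj D. \<forall>g \<in> Hom D zero Y. mono_arr D g)"
  using pretorsion_theory_if_epi_mono[OF assms] epi_if_pretorsion_theory[OF assms]
    mono_if_pretorsion_theory[OF assms] by blast

end
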